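(* Let $I=[0,1]$, let $n\ge 5$ be an integer and $h=\frac1n$. For any function $f\in C^4(I)$ there exist two points $c,\bar c\in I$ such that $$E_Q(f,I)=\frac{23}{5760}\,h^4\,D^4f(c)-\frac{1}{192}\,h^5\,D^4f(\bar c),$$ where $E_Q(f,I)=\int_0^1 f(x)\,dx-\mathcal I_Q(f,I)$ is the error of the quadrature formula $\mathcal I_Q$ on the uniform partition of $I$ with step $h$.
   Context: Set $\theta_0=0$, $\theta_{n+1}=1$, $\theta_i=(i-\frac12)h$ for $1\le i\le n$, and $f_i=f(\theta_i)$. The quadrature formula (obtained by integrating the $C^1$ quadratic spline quasi-interpolant on the uniform partition) is $$\mathcal I_Q(f,I)=h\Big[\tfrac19(f_0+f_{n+1})+\tfrac78(f_1+f_n)+\tfrac{73}{72}(f_2+f_{n-1})+\sum_{i=3}^{n-2}f_i\Big].$$ $D^4f$ denotes the fourth derivative of $f$. *)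

theory Defs
  imports "HOL-Analysis.Analysis"
begin

text \<open>Derivatives are taken within \<open>S\<close>, hence one-sided at the end points of a compact interval.
  Values outside \<open>S\<close> are meaningless and do not influence those inside \<open>S\<close>.\<close>

primrec nth_deriv_within :: "nat \<Rightarrow> (real \<Rightarrow> real) \<Rightarrow> real set \<Rightarrow> real \<Rightarrow> real" where
  "nth_deriv_within 0 f S = f"
| "nth_deriv_within (Suc k) f S = (\<lambda>x. vector_derivative (nth_deriv_within k f S) (at x within S))"

definition Ck_on :: "nat \<Rightarrow> (real \<Rightarrow> real) \<Rightarrow> real set \<Rightarrow> bool" where
  "Ck_on k f S \<longleftrightarrow>
     (\<forall>j<k. nth_deriv_within j f S differentiable_on S) \<and> continuous_on S (nth_deriv_within k f S)"

definition node :: "nat \<Rightarrow> nat \<Rightarrow> real" where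
  "node n i = (if i = 0 then 0 else if i = n + 1 then 1 else (real i - 1/2) * (1 / real n))"

definition quad_IQ :: "nat \<Rightarrow> (real \<Rightarrow> real) \<Rightarrow> real" where
  "quad_IQ n f =
     (let h = 1 / real n; F = (\<lambda>i. f (node n i)) in
      h * (1/9 * (F 0 + F (n + 1)) + 7/8 * (F 1 + F n) + 73/72 * (F 2 + F (n - 1))
           + (\<Sum>i=3..n-2. F i)))"

definition error_EQ :: "nat \<Rightarrow> (real \<Rightarrow> real) \<Rightarrow> real" where
  "error_EQ n f = integral {0..1} f - quad_IQ n f"

end

theory Submission
  imports Defs
begin

text \<open>
  The rule is exact on cubics, so its error is \<open>\<integral> K(t) f''''(t) dt\<close> for a Peano kernel \<open>K\<close>, a piecewise
  quartic with break points at the nodes. A short computation shows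
  \<open>\<integral> K = 23/5760 h^4 - 1/192 h^5\<close>. If \<open>K = A - B\<close> with \<open>A, B \<ge> 0\<close> and \<open>\<beta> = \<integral> B \<le> 1/192 h^5\<close>, then with
  \<open>m \<le> f'''' \<le> M\<close> the error lies between \<open>\<alpha> m - \<beta> M\<close> and \<open>\<alpha> M - \<beta> m\<close>, where \<open>\<alpha> = \<integral> A\<close>. Adding the same
  nonnegative amount to \<open>\<alpha>\<close> and \<open>\<beta>\<close> only widens this interval, so the bounds also hold with
  \<open>23/5760 h^4\<close> and \<open>1/192 h^5\<close> in place of \<open>\<alpha>\<close> and \<open>\<beta>\<close>. The intermediate value theorem, applied along a
  path that exchanges a minimiser and a maximiser of \<open>f''''\<close>, turns the enclosure into an equation
  (\<open>peano_enclosure_IVT\<close>).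

  It remains to know \<open>K\<close> well enough. Between consecutive nodes away from the ends it is
  \<open>h^4/384 + r^2 (r - h)^2 / 24\<close>, with \<open>r\<close> the distance to the left node, hence positive
  (\<open>inner_cell\<close>). Between the first two interior nodes it is still nonnegative (\<open>second_cell\<close>). On
  the half cell at the left end it is \<open>t^4/24 - h t^3/54\<close>, which changes sign, and the mass of the subtracted
  part is only \<open>h^5/3456\<close> (\<open>first_half_cell\<close>). The right end is the mirror image. The two ends
  together give \<open>\<beta> = h^5/1728\<close>.

  Each piece is treated by integrating by parts four times on its own interval. The boundary
  values at the nodes supply the quadrature weights. What is left over where two pieces meet
  is a combination of \<open>f'\<close>, \<open>f''\<close> and \<open>f'''\<close> that is the same from both sides and cancels.
\<close>

section \<open>Functions with four successive derivatives\<close>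

text \<open>The successive derivatives are carried as a family, so that reflection and restriction act on
  the family itself and no uniqueness of derivatives at end points is involved.\<close>

definition derivative_chain :: "(nat \<Rightarrow> real \<Rightarrow> real) \<Rightarrow> real set \<Rightarrow> bool" where
  "derivative_chain d S \<longleftrightarrow>
     (\<forall>j<4. \<forall>x\<in>S. (d j has_real_derivative d (Suc j) x) (at x within S)) \<and> continuous_on S (d 4)"

lemma derivative_chain_subset:
  assumes "derivative_chain d S" "T \<subseteq> S"
  shows "derivative_chain d T"
  using assms unfolding derivative_chain_def
  by (meson DERIV_subset continuous_on_subset subsetD)

lemma derivative_chain_integrable:
  assumes "derivative_chain d {u..v}"
  shows "d 0 integrable_on {u..v}"
proof -
  have "continuous_on {u..v} (d 0)"
    using assms unfolding derivative_chain_def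
    by (intro DERIV_continuous_on[where D = "d (Suc 0)"]) auto
  then show ?thesis by (rule integrable_continuous_real)
qed

lemma derivative_chain_reflect:
  assumes "derivative_chain d {a - v..a - u}"
  shows "derivative_chain (\<lambda>j x. (-1) ^ j * d j (a - x)) {u..v}"
proof -
  have img: "(\<lambda>x. a - x) ` {u..v} = {a - v..a - u}" by simp
  have "((\<lambda>x. (-1) ^ j * d j (a - x)) has_real_derivative (-1) ^ Suc j * d (Suc j) (a - x))
          (at x within {u..v})" if "j < 4" "x \<in> {u..v}" for j x
  proof -
    have "(d j has_real_derivative d (Suc j) (a - x)) (at (a - x) within (\<lambda>x. a - x) ` {u..v})"
      using assms that unfolding derivative_chain_def img by auto
    then have "(d j \<circ> (\<lambda>x. a - x) has_real_derivative d (Suc j) (a - x) * (-1)) (at x within {u..v})"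
      by (rule DERIV_image_chain) (auto intro!: derivative_eq_intros)
    then have "((\<lambda>x. d j (a - x)) has_real_derivative - d (Suc j) (a - x)) (at x within {u..v})"
      by (simp add: o_def)
    from DERIV_cmult[OF this, of "(-1) ^ j"] show ?thesis by simp
  qed
  moreover have "continuous_on {u..v} (\<lambda>x. (-1) ^ 4 * d 4 (a - x))"
  proof -
    have "continuous_on ((\<lambda>x. a - x) ` {u..v}) (d 4)"
      using assms unfolding derivative_chain_def img by auto
    then have "continuous_on {u..v} (\<lambda>x. d 4 (a - x))"
      by (rule continuous_on_compose2) (auto intro!: continuous_intros)
    then show ?thesis by simp
  qed
  ultimately show ?thesis unfolding derivative_chain_def by auto
qed

lemma Ck_on_derivative_chain:
  assumes "Ck_on 4 f S"
  shows "derivative_chain (\<lambda>j. nth_deriv_within j f S) S"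
proof -
  have "(nth_deriv_within j f S has_real_derivative nth_deriv_within (Suc j) f S x) (at x within S)"
    if "j < 4" "x \<in> S" for j x
  proof -
    have "nth_deriv_within j f S differentiable (at x within S)"
      using assms that unfolding Ck_on_def differentiable_on_def by auto
    then show ?thesis
      by (simp add: has_real_derivative_iff_has_vector_derivative flip: vector_derivative_works)
  qed
  then show ?thesis
    using assms unfolding derivative_chain_def Ck_on_def by auto
qed

section \<open>Integration by parts against a quartic\<close>

text \<open>The parameters are the values at \<open>r = 0\<close> of the kernel and of its first three derivatives.
  Adjacent kernel pieces share the first three of these data at a node, and the fourth jumps by the
  quadrature weight. The scaling makes the fourth derivative equal to \<open>1\<close>.\<close>

definition monic_quartic :: "real \<Rightarrow> real \<Rightarrow> real \<Rightarrow> real \<Rightarrow> real \<Rightarrow> real" where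
  "monic_quartic p0 p1 p2 p3 r = p0 + p1 * r + p2 * r^2 / 2 + p3 * r^3 / 6 + r^4 / 24"

text \<open>This is \<open>P''' f - P'' f' + P' f'' - P f'''\<close> for the quartic \<open>P\<close> centred at \<open>z\<close>. Since \<open>P'''' = 1\<close>,
  its derivative is \<open>f - P f''''\<close>.\<close>

definition boundary_term ::
  "real \<Rightarrow> real \<Rightarrow> real \<Rightarrow> real \<Rightarrow> real \<Rightarrow> (nat \<Rightarrow> real \<Rightarrow> real) \<Rightarrow> real \<Rightarrow> real" where
  "boundary_term p0 p1 p2 p3 z d t =
     (p3 + (t - z)) * d 0 t
     - (p2 + p3 * (t - z) + (t - z)^2 / 2) * d 1 t
     + (p1 + p2 * (t - z) + p3 * (t - z)^2 / 2 + (t - z)^3 / 6) * d 2 t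
     - monic_quartic p0 p1 p2 p3 (t - z) * d 3 t"

lemma quartic_integration_by_parts:
  assumes "derivative_chain d {u..v}" "u \<le> v"
  shows "((\<lambda>t. d 0 t - monic_quartic p0 p1 p2 p3 (t - z) * d 4 t) has_integral
           boundary_term p0 p1 p2 p3 z d v - boundary_term p0 p1 p2 p3 z d u) {u..v}"
proof (rule fundamental_theorem_of_calculus)
  fix x assume x: "x \<in> {u..v}"
  have D: "(d 0 has_real_derivative d 1 x) (at x within {u..v})"
    "(d 1 has_real_derivative d 2 x) (at x within {u..v})"
    "(d 2 has_real_derivative d 3 x) (at x within {u..v})"
    "(d 3 has_real_derivative d 4 x) (at x within {u..v})"
    using assms x unfolding derivative_chain_def by (auto simp: numeral_eq_Suc)
  show "(boundary_term p0 p1 p2 p3 z d has_vector_derivative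
          d 0 x - monic_quartic p0 p1 p2 p3 (x - z) * d 4 x) (at x within {u..v})"
    unfolding boundary_term_def monic_quartic_def has_real_derivative_iff_has_vector_derivative[symmetric]
    by (rule derivative_eq_intros D refl | simp)+ (simp add: field_simps power2_eq_square power3_eq_cube)
qed (use assms in auto)

lemma monic_quartic_has_integral:
  assumes "u \<le> v"
  shows "((\<lambda>t. monic_quartic p0 p1 p2 p3 (t - z)) has_integral
           (p0 * (v - z) + p1 * (v - z)^2 / 2 + p2 * (v - z)^3 / 6 + p3 * (v - z)^4 / 24 + (v - z)^5 / 120)
           - (p0 * (u - z) + p1 * (u - z)^2 / 2 + p2 * (u - z)^3 / 6 + p3 * (u - z)^4 / 24 + (u - z)^5 / 120))
         {u..v}"
  unfolding monic_quartic_def using assms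
  by (intro fundamental_theorem_of_calculus)
     (auto simp flip: has_real_derivative_iff_has_vector_derivative simp: field_simps
           intro!: derivative_eq_intros)

section \<open>Enclosures from kernels split into nonnegative parts\<close>

text \<open>The range allowed for \<open>\<integral> (A - B) g\<close> when \<open>m \<le> g \<le> M\<close> and \<open>A, B \<ge> 0\<close> have integrals \<open>\<alpha>\<close> and \<open>\<beta>\<close>.\<close>

definition peano_enclosure :: "real \<Rightarrow> real \<Rightarrow> real \<Rightarrow> real \<Rightarrow> real set" where
  "peano_enclosure m M \<alpha> \<beta> = {m * \<alpha> - M * \<beta>..M * \<alpha> - m * \<beta>}"

lemma peano_enclosure_add:
  assumes "x \<in> peano_enclosure m M \<alpha> \<beta>" "y \<in> peano_enclosure m M \<alpha>' \<beta>'"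
  shows "x + y \<in> peano_enclosure m M (\<alpha> + \<alpha>') (\<beta> + \<beta>')"
  using assms unfolding peano_enclosure_def by (auto simp: algebra_simps)

text \<open>Mass that is added to both parts of a kernel cancels in the kernel but loosens the
  enclosure, by \<open>M - m\<close> per unit of mass at either end. This leaves room for the rather generous constant
  \<open>1/192\<close>.\<close>

lemma peano_enclosure_mono:
  assumes "x \<in> peano_enclosure m M \<alpha> \<beta>" "\<alpha>' - \<beta>' = \<alpha> - \<beta>" "\<beta> \<le> \<beta>'" "m \<le> M"
  shows "x \<in> peano_enclosure m M \<alpha>' \<beta>'"
proof -
  have "\<alpha>' = \<alpha> + (\<beta>' - \<beta>)" using assms(2) by (simp add: algebra_simps)
  moreover have "0 \<le> (M - m) * (\<beta>' - \<beta>)" using assms by simp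
  ultimately show ?thesis
    using assms(1) unfolding peano_enclosure_def \<open>\<alpha>' = _\<close> by (auto simp: algebra_simps)
qed

text \<open>The sharp bounds \<open>m = g q\<close> and \<open>M = g p\<close> are attained, so the end points of the enclosure are
  values of \<open>\<alpha> * g c - \<beta> * g c'\<close>, namely at \<open>(c, c') = (q, p)\<close> and \<open>(p, q)\<close>. Moving \<open>c\<close> and \<open>c'\<close>
  along the segment between \<open>p\<close> and \<open>q\<close> in opposite directions connects them continuously.\<close>

lemma peano_enclosure_IVT:
  fixes a b :: real
  assumes cont: "continuous_on {a..b} g" and "a \<le> b"
    and enc: "\<And>m M. (\<And>x. x \<in> {a..b} \<Longrightarrow> m \<le> g x \<and> g x \<le> M) \<Longrightarrow> e \<in> peano_enclosure m M \<alpha> \<beta>"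
  shows "\<exists>c\<in>{a..b}. \<exists>c'\<in>{a..b}. e = \<alpha> * g c - \<beta> * g c'"
proof -
  obtain q where q: "q \<in> {a..b}" "\<And>x. x \<in> {a..b} \<Longrightarrow> g q \<le> g x"
    using continuous_attains_inf[OF compact_Icc[of a b] _ cont] \<open>a \<le> b\<close> by auto
  obtain p where p: "p \<in> {a..b}" "\<And>x. x \<in> {a..b} \<Longrightarrow> g x \<le> g p"
    using continuous_attains_sup[OF compact_Icc[of a b] _ cont] \<open>a \<le> b\<close> by auto
  define \<gamma> where "\<gamma> x y s = (1 - s) *\<^sub>R x + s *\<^sub>R y" for x y s :: real
  have \<gamma>: "\<gamma> x y s \<in> {a..b}" if "x \<in> {a..b}" "y \<in> {a..b}" "s \<in> {0..1}" for x y s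
    unfolding \<gamma>_def using convex_real_interval(5)[of a b] that by (intro convexD) auto
  define \<phi> where "\<phi> s = \<alpha> * g (\<gamma> q p s) - \<beta> * g (\<gamma> p q s)" for s
  have "continuous_on {0..1} (\<lambda>s. g (\<gamma> x y s))" if "x \<in> {a..b}" "y \<in> {a..b}" for x y
  proof (rule continuous_on_compose2[OF cont])
    show "continuous_on {0..1} (\<gamma> x y)" unfolding \<gamma>_def by (intro continuous_intros)
  qed (use \<gamma> that in blast)
  then have "continuous_on {0..1} \<phi>"
    unfolding \<phi>_def using p q by (intro continuous_intros) auto
  moreover have "\<phi> 0 \<le> e" "e \<le> \<phi> 1"
    using enc[of "g q" "g p"] p q unfolding \<phi>_def \<gamma>_def peano_enclosure_def
    by (auto simp: mult.commute)
  ultimately obtain s where "s \<in> {0..1}" "\<phi> s = e"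
    using IVT'[of \<phi> 0 e 1] by auto
  then show ?thesis unfolding \<phi>_def using \<gamma> p q by metis
qed

text \<open>The remainder after integrating by parts is \<open>\<integral> (A - B) f''''\<close>, and each part is
  estimated separately with the bounds on \<open>f''''\<close>.\<close>

lemma peano_piece:
  assumes chain: "derivative_chain d {u..v}" and uv: "u \<le> v"
    and bd: "\<And>x. x \<in> {u..v} \<Longrightarrow> m \<le> d 4 x \<and> d 4 x \<le> M"
    and split: "\<And>t. monic_quartic p0 p1 p2 p3 (t - z) = A t - B t"
    and nonneg: "\<And>t. t \<in> {u..v} \<Longrightarrow> 0 \<le> A t \<and> 0 \<le> B t"
    and A: "(A has_integral \<alpha>) {u..v}" and B: "(B has_integral \<beta>) {u..v}"
  shows "integral {u..v} (d 0)
           - (boundary_term p0 p1 p2 p3 z d v - boundary_term p0 p1 p2 p3 z d u)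
         \<in> peano_enclosure m M \<alpha> \<beta>"
proof -
  let ?G = "boundary_term p0 p1 p2 p3 z d v - boundary_term p0 p1 p2 p3 z d u"
  have I: "((\<lambda>t. (A t - B t) * d 4 t) has_integral integral {u..v} (d 0) - ?G) {u..v}"
    using has_integral_diff[OF integrable_integral[OF derivative_chain_integrable[OF chain]]
        quartic_integration_by_parts[OF chain uv, of p0 p1 p2 p3 z]]
    by (simp add: split)
  have lo: "((\<lambda>t. m * A t - M * B t) has_integral m * \<alpha> - M * \<beta>) {u..v}"
    and hi: "((\<lambda>t. M * A t - m * B t) has_integral M * \<alpha> - m * \<beta>) {u..v}"
    by (intro has_integral_diff has_integral_mult_right A B)+
  have pt: "m * A t - M * B t \<le> (A t - B t) * d 4 t \<and> (A t - B t) * d 4 t \<le> M * A t - m * B t"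
    if "t \<in> {u..v}" for t
  proof -
    have "m * A t \<le> d 4 t * A t" "d 4 t * A t \<le> M * A t"
         "m * B t \<le> d 4 t * B t" "d 4 t * B t \<le> M * B t"
      using nonneg[OF that] bd[OF that] by (auto intro: mult_right_mono)
    then show ?thesis by (simp add: algebra_simps)
  qed
  show ?thesis
    unfolding peano_enclosure_def
    using has_integral_le[OF lo I] has_integral_le[OF I hi] pt by auto
qed

section \<open>The pieces of the kernel\<close>

text \<open>The derivative terms left at a node where the kernel has value \<open>h^4/384\<close>, slope \<open>0\<close> and
  second derivative \<open>h^2/12\<close>. This is the case at every node from \<open>3/2*h\<close> to \<open>1 - 3/2*h\<close>, so
  these terms cancel between neighbouring pieces.\<close>

definition end_functional :: "real \<Rightarrow> (nat \<Rightarrow> real \<Rightarrow> real) \<Rightarrow> real \<Rightarrow> real" where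
  "end_functional h d x = h^2 / 12 * d 1 x + h^4 / 384 * d 3 x"

text \<open>At the end point the kernel vanishes with its first two derivatives, and its third
  derivative \<open>- h/9\<close> is minus the weight of the function value at \<open>0\<close>. The two monomials have opposite signs and serve as \<open>A\<close> and \<open>B\<close>.\<close>

lemma first_half_cell:
  assumes h: "h > 0" and chain: "derivative_chain d {0..h/2}"
    and bd: "\<And>x. x \<in> {0..h/2} \<Longrightarrow> m \<le> d 4 x \<and> d 4 x \<le> M"
  shows "integral {0..h/2} (d 0)
           - (boundary_term 0 0 0 (- h/9) 0 d (h/2) - boundary_term 0 0 0 (- h/9) 0 d 0)
         \<in> peano_enclosure m M (1/3840 * h^5) (1/3456 * h^5)"
proof -
  have A: "((\<lambda>t. monic_quartic 0 0 0 0 (t - 0)) has_integral 1/3840 * h^5) {0..h/2}"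
    using monic_quartic_has_integral[of 0 "h/2" 0 0 0 0 0] h by (simp add: field_simps)
  have "((\<lambda>t. h/54 * t^3) has_integral h/216 * (h/2)^4 - h/216 * 0^4) {0..h/2}"
    using h by (intro fundamental_theorem_of_calculus)
     (auto simp flip: has_real_derivative_iff_has_vector_derivative simp: field_simps
           intro!: derivative_eq_intros)
  moreover have "h/216 * (h/2)^4 - h/216 * 0^4 = 1/3456 * h^5"
    by (simp add: power_divide eval_nat_numeral)
  ultimately have B: "((\<lambda>t. h/54 * t^3) has_integral 1/3456 * h^5) {0..h/2}"
    by (simp only:)
  show ?thesis
    by (rule peano_piece[OF chain _ bd _ _ A B]) (use h in \<open>simp_all add: monic_quartic_def\<close>)
qed

text \<open>At the node \<open>h/2\<close> this quartic agrees with \<open>t^4/24 - h t^3/54\<close> up to the second derivative, while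
  the third derivative drops by the weight \<open>7/8 h\<close>. Its expansion is taken at the right node because
  there the linear term vanishes and the value and curvature are those of the inner cells.\<close>

lemma second_cell:
  assumes h: "h > 0" and chain: "derivative_chain d {h/2..3/2*h}"
    and bd: "\<And>x. x \<in> {h/2..3/2*h} \<Longrightarrow> m \<le> d 4 x \<and> d 4 x \<le> M"
  shows "integral {h/2..3/2*h} (d 0)
           - (boundary_term (h^4/384) 0 (h^2/12) (37/72*h) (3/2*h) d (3/2*h)
              - boundary_term (h^4/384) 0 (h^2/12) (37/72*h) (3/2*h) d (h/2))
         \<in> peano_enclosure m M (59/17280 * h^5) 0"
proof -
  let ?Q = "\<lambda>t. monic_quartic (h^4/384) 0 (h^2/12) (37/72*h) (t - 3/2*h)"
  have A: "(?Q has_integral 59/17280 * h^5) {h/2..3/2*h}"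
    using monic_quartic_has_integral[of "h/2" "3/2*h" "h^4/384" 0 "h^2/12" "37/72*h" "3/2*h"] h
    by (simp add: field_simps eval_nat_numeral)
  have B: "((\<lambda>t. 0) has_integral 0) {h/2..3/2*h}" by simp
  have nonneg: "0 \<le> ?Q t" if t: "t \<in> {h/2..3/2*h}" for t
  proof -
    define r where "r = 3/2*h - t"
    have r: "0 \<le> r" "r \<le> h" using t by (auto simp: r_def)
    have r2: "r^2 \<le> h^2" using r by (intro power_mono) auto
    \<comment> \<open>Completing the square leaves a deficit of at most \<open>73/31104 h^4\<close>, less than the
      constant term \<open>h^4/384 = 81/31104 h^4\<close>.\<close>
    have "?Q t = h^4/384 + r^2 * (r - 37/36*h)^2 / 24 - 73/31104 * (r^2 * h^2)"
      unfolding monic_quartic_def r_def by (simp add: field_simps eval_nat_numeral)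
    moreover have "r^2 * h^2 \<le> h^4"
      using mult_right_mono[OF r2, of "h^2"] by (simp flip: power_add)
    moreover have "0 \<le> r^2 * (r - 37/36*h)^2" "0 \<le> h^4" by simp_all
    ultimately show ?thesis by linarith
  qed
  show ?thesis
    by (rule peano_piece[OF chain _ bd _ _ A B]) (use h nonneg in auto)
qed

text \<open>The node \<open>3/2*h\<close> gets only \<open>37/72\<close> here. The adjacent inner cell contributes another \<open>1/2\<close>,
  and together they make up the weight \<open>73/72\<close>.\<close>

lemma left_end:
  assumes h: "h > 0" and chain: "derivative_chain d {0..3/2*h}"
    and bd: "\<And>x. x \<in> {0..3/2*h} \<Longrightarrow> m \<le> d 4 x \<and> d 4 x \<le> M"
  shows "integral {0..3/2*h} (d 0) - h * (1/9 * d 0 0 + 7/8 * d 0 (h/2) + 37/72 * d 0 (3/2*h))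
           + end_functional h d (3/2*h)
         \<in> peano_enclosure m M (127/34560 * h^5) (1/3456 * h^5)"
proof -
  have c1: "derivative_chain d {0..h/2}" and c2: "derivative_chain d {h/2..3/2*h}"
    using h by (auto intro: derivative_chain_subset[OF chain])
  let ?G1 = "boundary_term 0 0 0 (- h/9) 0 d (h/2) - boundary_term 0 0 0 (- h/9) 0 d 0"
  let ?G2 = "boundary_term (h^4/384) 0 (h^2/12) (37/72*h) (3/2*h) d (3/2*h)
              - boundary_term (h^4/384) 0 (h^2/12) (37/72*h) (3/2*h) d (h/2)"
  have "integral {0..h/2} (d 0) + integral {h/2..3/2*h} (d 0) = integral {0..3/2*h} (d 0)"
    using h derivative_chain_integrable[OF chain]
    by (intro Henstock_Kurzweil_Integration.integral_combine) auto
  moreover have "?G1 + ?G2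
      = h * (1/9 * d 0 0 + 7/8 * d 0 (h/2) + 37/72 * d 0 (3/2*h)) - end_functional h d (3/2*h)"
    unfolding boundary_term_def end_functional_def monic_quartic_def
    by (simp add: field_simps eval_nat_numeral)
  ultimately have eq: "integral {0..3/2*h} (d 0)
      - h * (1/9 * d 0 0 + 7/8 * d 0 (h/2) + 37/72 * d 0 (3/2*h)) + end_functional h d (3/2*h)
      = (integral {0..h/2} (d 0) - ?G1) + (integral {h/2..3/2*h} (d 0) - ?G2)"
    by linarith
  have \<alpha>: "127/34560 * h^5 = 1/3840 * h^5 + 59/17280 * h^5"
    and \<beta>: "1/3456 * h^5 = 1/3456 * h^5 + 0" by simp_all
  show ?thesis
    unfolding eq \<alpha> by (subst \<beta>, intro peano_enclosure_add first_half_cell second_cell h c1 c2)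
      (use bd h in auto)
qed

text \<open>The reflection \<open>x \<mapsto> a - x\<close> flips the sign of the odd derivatives, hence of
  \<open>end_functional\<close>, while the bounds on the fourth derivative persist.\<close>

lemma right_end:
  assumes h: "h > 0" and chain: "derivative_chain d {a - 3/2*h..a}"
    and bd: "\<And>x. x \<in> {a - 3/2*h..a} \<Longrightarrow> m \<le> d 4 x \<and> d 4 x \<le> M"
  shows "integral {a - 3/2*h..a} (d 0)
           - h * (1/9 * d 0 a + 7/8 * d 0 (a - h/2) + 37/72 * d 0 (a - 3/2*h))
           - end_functional h d (a - 3/2*h)
         \<in> peano_enclosure m M (127/34560 * h^5) (1/3456 * h^5)"
proof -
  define e where "e j x = (-1) ^ j * d j (a - x)" for j x
  have e0: "e 0 = (\<lambda>x. d 0 (a - x))" by (simp add: e_def fun_eq_iff)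
  have chain': "derivative_chain e {0..3/2*h}"
    unfolding e_def using chain by (intro derivative_chain_reflect) simp
  have "integral {0..3/2*h} (e 0) = integral {a - 3/2*h..a} (d 0)"
  proof -
    have "((\<lambda>x. d 0 (- 1 *\<^sub>R x + a)) has_integral
        (1 / \<bar>- 1\<bar> ^ DIM(real)) *\<^sub>R integral {a - 3/2*h..a} (d 0))
        ((\<lambda>x. (1 / - 1) *\<^sub>R x + - ((1 / - 1) *\<^sub>R a)) ` cbox (a - 3/2*h) a)"
      using integrable_integral[OF derivative_chain_integrable[OF chain]]
      by (intro has_integral_affinity) auto
    moreover have "(\<lambda>x. (1 / - 1) *\<^sub>R x + - ((1 / - 1) *\<^sub>R a)) ` cbox (a - 3/2*h) a = {0..3/2*h}"
      by auto
    ultimately show ?thesis by (simp add: integral_unique e0)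
  qed
  then show ?thesis
    using left_end[OF h chain', of m M] bd
    unfolding end_functional_def by (simp add: e_def algebra_simps)
qed

text \<open>Here the kernel is that of the trapezoidal rule with derivative corrections at both ends. As a
  sum of a positive constant and a square it needs no subtracted part.\<close>

lemma inner_cell:
  assumes h: "h > 0" and chain: "derivative_chain d {x..x + h}"
    and bd: "\<And>t. t \<in> {x..x + h} \<Longrightarrow> m \<le> d 4 t \<and> d 4 t \<le> M"
  shows "integral {x..x + h} (d 0) - h * ((d 0 x + d 0 (x + h)) / 2)
           + end_functional h d (x + h) - end_functional h d x
         \<in> peano_enclosure m M (23/5760 * h^5) 0"
proof -
  let ?Q = "\<lambda>t. monic_quartic (h^4/384) 0 (h^2/12) (- h/2) (t - x)"
  have A: "(?Q has_integral 23/5760 * h^5) {x..x + h}"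
    using monic_quartic_has_integral[of x "x + h" "h^4/384" 0 "h^2/12" "- h/2" x] h
    by (simp add: field_simps eval_nat_numeral)
  have B: "((\<lambda>t. 0) has_integral 0) {x..x + h}" by simp
  have "?Q t = h^4/384 + (t - x)^2 * (t - x - h)^2 / 24" for t
    unfolding monic_quartic_def by (simp add: field_simps eval_nat_numeral)
  then have nonneg: "0 \<le> ?Q t" for t by simp
  have "boundary_term (h^4/384) 0 (h^2/12) (- h/2) x d (x + h)
          - boundary_term (h^4/384) 0 (h^2/12) (- h/2) x d x
        = h * ((d 0 x + d 0 (x + h)) / 2) - end_functional h d (x + h) + end_functional h d x"
    unfolding boundary_term_def end_functional_def monic_quartic_def
    by (simp add: field_simps eval_nat_numeral)
  then have eq: "integral {x..x + h} (d 0) - h * ((d 0 x + d 0 (x + h)) / 2)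
      + end_functional h d (x + h) - end_functional h d x = integral {x..x + h} (d 0)
      - (boundary_term (h^4/384) 0 (h^2/12) (- h/2) x d (x + h)
          - boundary_term (h^4/384) 0 (h^2/12) (- h/2) x d x)"
    by linarith
  show ?thesis unfolding eq
    by (rule peano_piece[OF chain _ bd _ _ A B]) (use h nonneg in auto)
qed

text \<open>The trapezoidal sum is written as the full sum minus half the end values, which keeps it
  correct for \<open>k = 0\<close>.\<close>

lemma inner_cells:
  assumes h: "h > 0" and chain: "derivative_chain d {x..x + real k * h}"
    and bd: "\<And>t. t \<in> {x..x + real k * h} \<Longrightarrow> m \<le> d 4 t \<and> d 4 t \<le> M"
  shows "integral {x..x + real k * h} (d 0)
           - h * ((\<Sum>i\<le>k. d 0 (x + real i * h)) - (d 0 x + d 0 (x + real k * h)) / 2)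
           + end_functional h d (x + real k * h) - end_functional h d x
         \<in> peano_enclosure m M (real k * (23/5760 * h^5)) 0"
  using chain bd
proof (induction k)
  case 0
  then show ?case by (simp add: peano_enclosure_def)
next
  case (Suc k)
  let ?y = "x + real k * h"
  have y: "x + real (Suc k) * h = ?y + h" by (simp add: algebra_simps)
  have sub: "{x..?y} \<subseteq> {x..?y + h}" "{?y..?y + h} \<subseteq> {x..?y + h}"
    using h by auto
  have chain': "derivative_chain d {x..?y + h}" using Suc.prems(1) unfolding y .
  have bd': "m \<le> d 4 t \<and> d 4 t \<le> M" if "t \<in> {x..?y + h}" for t
    using Suc.prems(2)[of t] that unfolding y .
  have I: "integral {x..?y + h} (d 0) = integral {x..?y} (d 0) + integral {?y..?y + h} (d 0)"
    using h derivative_chain_integrable[OF chain']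
    by (intro Henstock_Kurzweil_Integration.integral_combine[symmetric]) auto
  note peano_enclosure_add[OF
      Suc.IH[OF derivative_chain_subset[OF chain' sub(1)] bd'[OF subsetD[OF sub(1)]]]
      inner_cell[OF h derivative_chain_subset[OF chain' sub(2)] bd'[OF subsetD[OF sub(2)]]]]
  then show ?case
    unfolding y I sum.atMost_Suc by (simp add: algebra_simps add_divide_distrib)
qed

section \<open>The quadrature error\<close>

text \<open>The interval is cut at \<open>3/2*h\<close> and \<open>1 - 3/2*h\<close>. There are \<open>n - 3\<close> inner cells between
  them, and the total mass of the kernel comes out as
  \<open>(n - 3) * 23/5760 h^5 + 2 * 117/34560 h^5\<close>, which equals \<open>23/5760 h^4 - 1/192 h^5\<close> because \<open>n * h = 1\<close>.\<close>

lemma error_EQ_enclosure: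
  assumes n: "n \<ge> 5" and h: "h = 1 / real n"
    and chain: "derivative_chain d {0..1}" and f: "d 0 = f"
    and bd: "\<And>x. x \<in> {0..1} \<Longrightarrow> m \<le> d 4 x \<and> d 4 x \<le> M"
  shows "error_EQ n f \<in> peano_enclosure m M (23/5760 * h^4) (1/192 * h^5)"
proof -
  obtain k where k: "n = k + 3" "k \<ge> 2" using n by (intro that[of "n - 3"]) auto
  define a where "a = 3/2 * h"
  have h0: "h > 0" using h n by simp
  have nh: "(real k + 3) * h = 1" using h k by simp
  have b: "a + real k * h = 1 - a" using nh by (simp add: a_def algebra_simps)
  have ab: "0 \<le> a" "a \<le> 1 - a" "1 - a \<le> 1"
  proof -
    have "0 \<le> real k * h" "0 \<le> a" using h0 by (simp_all add: a_def)
    then show "0 \<le> a" "a \<le> 1 - a" "1 - a \<le> 1" using b by linarith+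
  qed
  have sub: "{0..a} \<subseteq> {0..1}" "{a..1 - a} \<subseteq> {0..1}" "{1 - a..1} \<subseteq> {0..1}"
    using ab by auto
  note ch = derivative_chain_subset[OF chain]
  have L: "integral {0..a} f - h * (1/9 * f 0 + 7/8 * f (h/2) + 37/72 * f a) + end_functional h d a
      \<in> peano_enclosure m M (127/34560 * h^5) (1/3456 * h^5)"
    using left_end[OF h0, of d m M] ch[OF sub(1)] bd subsetD[OF sub(1)] unfolding a_def f by blast
  have R: "integral {1 - a..1} f - h * (1/9 * f 1 + 7/8 * f (1 - h/2) + 37/72 * f (1 - a))
        - end_functional h d (1 - a)
      \<in> peano_enclosure m M (127/34560 * h^5) (1/3456 * h^5)"
    using right_end[OF h0, of d 1 m M] ch[OF sub(3)] bd subsetD[OF sub(3)] unfolding a_def f by blast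
  have C: "integral {a..1 - a} f - h * ((\<Sum>i\<le>k. f (a + real i * h)) - (f a + f (1 - a)) / 2)
        + end_functional h d (1 - a) - end_functional h d a
      \<in> peano_enclosure m M (real k * (23/5760 * h^5)) 0"
    using inner_cells[OF h0, of d a k m M] ch[OF sub(2)] bd subsetD[OF sub(2)] unfolding b f by blast
  have int: "f integrable_on {0..1}"
    using derivative_chain_integrable[OF chain] unfolding f .
  have I: "integral {0..1} f = integral {0..a} f + integral {a..1 - a} f + integral {1 - a..1} f"
    using ab int integrable_on_subinterval[OF int, of 0 "1 - a"]
    by (simp add: Henstock_Kurzweil_Integration.integral_combine)
  have nodes: "node n 0 = 0" "node n (n + 1) = 1" "node n 1 = h/2" "node n n = 1 - h/2"
    "node n 2 = a" "node n (n - 1) = 1 - a"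
    using k h n by (auto simp: node_def a_def field_simps)
  have sum: "(\<Sum>i\<le>k. f (a + real i * h)) = f a + (\<Sum>i=3..n-2. f (node n i)) + f (1 - a)"
  proof -
    have "(\<Sum>i\<le>k. f (a + real i * h)) = (\<Sum>i=0..k. f (node n (i + 2)))"
      unfolding atMost_atLeast0 using k
      by (intro sum.cong) (auto simp: node_def a_def algebra_simps h add_divide_distrib)
    also have "\<dots> = (\<Sum>i=0+2..k+2. f (node n i))"
      by (rule sum.shift_bounds_cl_nat_ivl[symmetric])
    also have "{0+2..k+2} = insert 2 (insert (n - 1) {3..n-2})" using k by auto
    also have "(\<Sum>i\<in>insert 2 (insert (n - 1) {3..n-2}). f (node n i))
        = f (node n 2) + (f (node n (n - 1)) + (\<Sum>i=3..n-2. f (node n i)))"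
    proof -
      have "2 \<notin> insert (n - 1) {3..n-2}" "n - 1 \<notin> {3..n-2}" using k by auto
      then show ?thesis by (simp only: sum.insert finite_insert finite_atLeastAtMost not_False_eq_True)
    qed
    finally show ?thesis unfolding nodes by linarith
  qed
  have quad: "quad_IQ n f = h * (1/9 * (f 0 + f 1) + 7/8 * (f (h/2) + f (1 - h/2))
      + 73/72 * (f a + f (1 - a)) + (\<Sum>i=3..n-2. f (node n i)))"
    unfolding quad_IQ_def Let_def nodes h ..
  have "error_EQ n f =
      (integral {0..a} f - h * (1/9 * f 0 + 7/8 * f (h/2) + 37/72 * f a) + end_functional h d a)
    + (integral {a..1 - a} f - h * ((\<Sum>i\<le>k. f (a + real i * h)) - (f a + f (1 - a)) / 2)
        + end_functional h d (1 - a) - end_functional h d a)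
    + (integral {1 - a..1} f - h * (1/9 * f 1 + 7/8 * f (1 - h/2) + 37/72 * f (1 - a))
        - end_functional h d (1 - a))"
    unfolding error_EQ_def quad I sum by (simp add: field_simps)
  then have "error_EQ n f \<in> peano_enclosure m M
      (127/34560 * h^5 + real k * (23/5760 * h^5) + 127/34560 * h^5) (1/3456 * h^5 + 0 + 1/3456 * h^5)"
    using peano_enclosure_add[OF peano_enclosure_add[OF L C] R] by (simp only:)
  moreover have "23/5760 * h^4 - 1/192 * h^5
      = 127/34560 * h^5 + real k * (23/5760 * h^5) + 127/34560 * h^5 - (1/3456 * h^5 + 0 + 1/3456 * h^5)"
    using nh by algebra
  moreover have "m \<le> M" using bd[of 0] by auto
  moreover have "1/3456 * h^5 + 0 + 1/3456 * h^5 \<le> 1/192 * h^5" using h0 by simp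
  ultimately show ?thesis by (metis peano_enclosure_mono)
qed

theorem theorem7:
  fixes n :: nat and h :: real and f :: "real \<Rightarrow> real"
  assumes "n \<ge> 5" and "h = 1 / real n"
    and "Ck_on 4 f {0..1}"
  shows "\<exists>c \<in> {0..1}. \<exists>c' \<in> {0..1}.
    error_EQ n f = 23 / 5760 * h ^ 4 * nth_deriv_within 4 f {0..1} c
                   - 1 / 192 * h ^ 5 * nth_deriv_within 4 f {0..1} c'"
proof (rule peano_enclosure_IVT)
  have chain: "derivative_chain (\<lambda>j. nth_deriv_within j f {0..1}) {0..1}"
    by (rule Ck_on_derivative_chain[OF assms(3)])
  then show "continuous_on {0..1} (nth_deriv_within 4 f {0..1})"
    unfolding derivative_chain_def by simp
  show "error_EQ n f \<in> peano_enclosure m M (23 / 5760 * h ^ 4) (1 / 192 * h ^ 5)"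
    if "\<And>x. x \<in> {0..1} \<Longrightarrow> m \<le> nth_deriv_within 4 f {0..1} x \<and> nth_deriv_within 4 f {0..1} x \<le> M" for m M
    by (rule error_EQ_enclosure[OF assms(1,2) chain _ that]) auto
qed simp

end
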